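(* For every $k\ge 0$, let $$r_k(x)=\begin{cases} q_k(x)/(x-1), & \text{if } k\equiv 1 \pmod 3,\\ q_k(x), & \text{otherwise}.\end{cases}$$ Then $r_k(x)$ is a polynomial in $\mathbb{Z}[x]$ that is irreducible over $\mathbb{Q}$. In particular $r_k$ is the minimal polynomial of $d_k$.
   Context: Define $q_k(x)\in\mathbb{Z}[x]$ by $q_0(x)=x^2-5x+3$, $q_1(x)=(x^3-8x^2+17x-5)(x-1)$, and $q_k(x)=(x^2-4x+2)q_{k-1}(x)-q_{k-2}(x)$ for $k\ge 2$. Let $d_k$ denote the largest real root of $q_k$ (in the source, $q_k$ is the characteristic polynomial of $A_k^tA_k$ divided by $(x-2)^2$ for the adjacency matrix $A_k$ of a certain bipartite graph, and $d_k$ is the square of its Perron–Frobenius eigenvalue). *)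

theory Defs
  imports "HOL-Computational_Algebra.Computational_Algebra"
begin

fun q :: "nat \<Rightarrow> int poly" where
  "q 0 = [:3, -5, 1:]"
| "q (Suc 0) = [:-5, 17, -8, 1:] * [:-1, 1:]"
| "q (Suc (Suc k)) = [:2, -4, 1:] * q (Suc k) - q k"

text \<open>r_k = q_k/(x-1) if k = 1 mod 3, else q_k (division in Z[x]; exactness is part of the theorem).\<close>
definition r :: "nat \<Rightarrow> int poly" where
  "r k = (if k mod 3 = 1 then q k div [:-1, 1:] else q k)"

definition d :: "nat \<Rightarrow> real" where
  "d k = Max {x :: real. poly (map_poly of_int (q k)) x = 0}"

end

theory Submission
  imports Defs "Berlekamp_Zassenhaus.Factor_Bound"
begin

text \<open>
  Put x = t + 1/t + 2. Then t^(2k+2) (t^4 - 1) q_k(x) = t^N P(t) + Q(t), where N = 4k + 5,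
  P(t) = t^3 - t^2 - t - 1 and Q(t) = t^3 + t^2 + t - 1. A Christoffel--Darboux identity for a
  three-term recurrence containing the q_k shows that all roots of q_k are real, simple and
  positive, and that at most one of them exceeds 4. Hence, if r_k had a nontrivial factorization
  over the integers, one monic factor g would have all its roots of the form t + 1/t + 2 with t on
  the unit circle.

  For a prime p the Dickson polynomial D_p (which sends t + 1/t to t^p + 1/t^p) is congruent to X^p
  modulo p, so g(D_p) = g^p + p H with H integral (here g is taken in the variable t + 1/t). The
  values of g(D_p) at the roots of g are bounded independently of p, so for large p the remainder of
  H modulo g has tiny values at all roots and must vanish: t \<mapsto> t^p preserves the set of
  the t's. Therefore every such t is a root of unity, and the set is closed under t \<mapsto> t^a
  for all a coprime to the order of t. According to the order of t modulo 4 this gives one of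
  t^2, -t^2 (and -t^4), or -t as a further solution of t^N P(t) + Q(t) = 0, and eliminating t^N
  leaves only t^4 = 1 or t^2 + t + 1 = 0. The former is excluded by the values of q_k at 0, 2, 4;
  the latter means x = 1, which is a (simple) root of q_k exactly when k = 1 mod 3.
\<close>

hide_const (open) up_ring.coeff Module.smult

section \<open>Dickson polynomials and monic integer polynomials with roots in [-2, 2]\<close>

fun dickson :: "nat \<Rightarrow> int poly" where
  "dickson 0 = [:2:]"
| "dickson (Suc 0) = [:0, 1:]"
| "dickson (Suc (Suc n)) = [:0, 1:] * dickson (Suc n) - dickson n"

lemma poly_dickson:
  fixes t :: "'a :: field_char_0"
  assumes "t \<noteq> 0"
  shows "poly (of_int_poly (dickson n)) (t + 1 / t) = t ^ n + (1 / t) ^ n"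
proof (induction n rule: dickson.induct)
  case (3 n)
  have "poly (of_int_poly (dickson (Suc (Suc n)))) (t + 1 / t)
     = (t + 1 / t) * (t ^ Suc n + (1 / t) ^ Suc n) - (t ^ n + (1 / t) ^ n)"
    by (simp add: 3 hom_distribs)
  also have "\<dots> = t ^ Suc (Suc n) + (1 / t) ^ Suc (Suc n)"
    using assms by (simp add: field_simps)
  finally show ?case .
qed (auto simp: hom_distribs)

text \<open>The recurrence read at every integer index: absolute values extend
  \<open>dickson\<close> evenly to negative indices, as t^n + t^(-n) is even in n, so the expansion
  below needs no case split in the middle.\<close>

lemma X_times_dickson:
  fixes i :: int
  shows "[:0, 1:] * dickson (nat \<bar>i\<bar>) = dickson (nat \<bar>i + 1\<bar>) + dickson (nat \<bar>i - 1\<bar>)"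
proof -
  have rec: "[:0, 1:] * dickson (Suc n) = dickson (Suc (Suc n)) + dickson n" for n
    by simp
  show ?thesis
  proof (cases i rule: int_cases3)
    case (pos n)
    then obtain m where "n = Suc m" by (cases n) auto
    with pos have "nat \<bar>i\<bar> = Suc m" "nat \<bar>i + 1\<bar> = Suc (Suc m)" "nat \<bar>i - 1\<bar> = m" by auto
    with rec show ?thesis by simp
  next
    case (neg n)
    then obtain m where "n = Suc m" by (cases n) auto
    with neg have "nat \<bar>i\<bar> = Suc m" "nat \<bar>i - 1\<bar> = Suc (Suc m)" "nat \<bar>i + 1\<bar> = m" by auto
    with rec show ?thesis by simp
  qed (simp add: numeral_poly)
qed

section \<open>Dickson polynomials and Frobenius modulo a prime\<close>

lemma sum_choose_Suc:
  fixes f :: "nat \<Rightarrow> 'a :: comm_semiring_1"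
  shows "(\<Sum>j\<le>Suc n. of_nat (Suc n choose j) * f j) = (\<Sum>j\<le>n. of_nat (n choose j) * (f j + f (Suc j)))"
proof -
  have "(\<Sum>j\<le>Suc n. of_nat (n choose j) * f j) = (\<Sum>j\<le>n. of_nat (n choose j) * f j)"
    by (simp add: binomial_eq_0)
  then have eq: "(\<Sum>j\<le>n. of_nat (n choose j) * f j) = f 0 + (\<Sum>j\<le>n. of_nat (n choose Suc j) * f (Suc j))"
    by (subst (asm) sum.atMost_Suc_shift) simp
  show ?thesis
    by (subst sum.atMost_Suc_shift) (simp add: distrib_left distrib_right sum.distrib eq add_ac)
qed

text \<open>This is the binomial expansion of (t + 1/t)^n with the terms for j and n - j paired.
  Each pair is counted twice, whence the factor 2; the middle term then needs no separate
  treatment.\<close>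

lemma two_X_power_eq_dickson_sum:
  "2 * [:0, 1:] ^ n = (\<Sum>j\<le>n. of_nat (n choose j) * dickson (nat \<bar>int n - 2 * int j\<bar>))"
proof (induction n)
  case (Suc n)
  have "2 * [:0, 1:] ^ Suc n = [:0, 1:] * (2 * [:0, 1:] ^ n)"
    by (simp only: power_Suc mult_ac)
  also have "\<dots> = (\<Sum>j\<le>n. of_nat (n choose j) * ([:0, 1:] * dickson (nat \<bar>int n - 2 * int j\<bar>)))"
    unfolding Suc.IH by (simp only: sum_distrib_left mult_ac)
  also have "\<dots> = (\<Sum>j\<le>n. of_nat (n choose j) *
      (dickson (nat \<bar>int (Suc n) - 2 * int j\<bar>) + dickson (nat \<bar>int (Suc n) - 2 * int (Suc j)\<bar>)))"
    unfolding X_times_dickson by (simp add: algebra_simps)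
  also have "\<dots> = (\<Sum>j\<le>Suc n. of_nat (Suc n choose j) * dickson (nat \<bar>int (Suc n) - 2 * int j\<bar>))"
    by (rule sum_choose_Suc [symmetric])
  finally show ?case .
qed (simp add: numeral_poly)

text \<open>Only the two end terms survive modulo p. The weights \<open>f\<close> stay arbitrary so
  that the statement serves both the Dickson expansion and the Frobenius identity.\<close>

lemma prime_dvd_sum_choose:
  fixes f :: "nat \<Rightarrow> 'a :: comm_ring_1"
  assumes "prime p"
  shows "of_nat p dvd (\<Sum>j\<le>p. of_nat (p choose j) * f j) - f 0 - f p"
proof -
  have p: "p > 1" using assms prime_gt_1_nat by auto
  have "{..p} = insert 0 (insert p {0<..<p})" using p by auto
  then have "(\<Sum>j\<le>p. of_nat (p choose j) * f j) - f 0 - f p = (\<Sum>j\<in>{0<..<p}. of_nat (p choose j) * f j)"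
    using p by simp
  also have "of_nat p dvd \<dots>"
  proof (intro dvd_sum dvd_mult2)
    fix j assume "j \<in> {0<..<p}"
    then have "p dvd p choose j" using assms p by (intro dvd_choose_prime) auto
    then show "of_nat p dvd (of_nat (p choose j) :: 'a)" by (metis dvd_def of_nat_mult)
  qed
  finally show ?thesis .
qed

lemma prime_dvd_power_add:
  fixes a b :: "'a :: comm_ring_1"
  assumes "prime p"
  shows "of_nat p dvd (a + b) ^ p - a ^ p - b ^ p"
  using prime_dvd_sum_choose[OF assms, of "\<lambda>j. a ^ j * b ^ (p - j)"]
  by (simp add: binomial_ring mult.assoc diff_diff_eq add.commute)

lemma of_nat_dvd_int_poly_iff: "(of_nat n :: int poly) dvd f \<longleftrightarrow> (\<forall>i. int n dvd coeff f i)"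
  by (simp add: of_nat_poly const_poly_dvd_iff)

text \<open>Both end terms in the expansion of 2 X^p equal \<open>dickson p\<close>, so p divides 2
  (X^p - D_p); oddness of p cancels the 2.\<close>

lemma prime_dvd_dickson_diff:
  assumes "prime p" "odd p"
  shows "of_nat p dvd dickson p - [:0, 1:] ^ p"
proof -
  have "of_nat p dvd 2 * [:0, 1:] ^ p - 2 * dickson p"
    using prime_dvd_sum_choose[OF assms(1), of "\<lambda>j. dickson (nat \<bar>int p - 2 * int j\<bar>)"]
    unfolding two_X_power_eq_dickson_sum by simp
  also have "2 * [:0, 1:] ^ p - 2 * dickson p = smult (-2) (dickson p - [:0, 1:] ^ p)"
    by (simp add: poly_eq_iff numeral_poly)
  finally have "int p dvd -2 * coeff (dickson p - [:0, 1:] ^ p) i" for i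
    unfolding of_nat_dvd_int_poly_iff coeff_smult by blast
  moreover have "\<not> int p dvd -2"
  proof
    assume "int p dvd -2"
    then have "int p dvd int 2" by simp
    then have "p dvd 2" by (simp only: of_nat_dvd_iff)
    then show False using assms primes_dvd_imp_eq[of p 2] by auto
  qed
  moreover have "prime (int p)" using assms by simp
  ultimately show ?thesis
    unfolding of_nat_dvd_int_poly_iff using prime_dvd_mult_iff by blast
qed

text \<open>Fermat's little theorem: induction with the Frobenius identity for naturals, then
  passage to the residue modulo p, which covers negative integers.\<close>

lemma prime_dvd_int_power_diff:
  fixes a :: int
  assumes "prime p"
  shows "int p dvd a ^ p - a"
proof -
  have pos: "int p dvd int n ^ p - int n" for n
  proof (induction n)
    case (Suc n)
    have "int p dvd ((1 + int n) ^ p - 1 ^ p - int n ^ p) + (int n ^ p - int n)"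
      using prime_dvd_power_add[OF assms, of 1 "int n"] Suc.IH by (intro dvd_add) auto
    then show ?case by (simp add: algebra_simps)
  qed (use assms prime_gt_0_nat in \<open>simp add: power_0_left\<close>)
  define n where "n = nat (a mod int p)"
  have "int n = a mod int p"
    using assms prime_gt_0_nat[of p] by (simp add: n_def)
  then have n: "int p dvd a - int n" by (simp add: minus_mod_eq_mult_div)
  have "int p dvd a ^ p - int n ^ p"
    using n by (simp add: power_diff_sumr2)
  then have "int p dvd (a ^ p - int n ^ p) + (int n ^ p - int n) - (a - int n)"
    by (intro dvd_diff[OF dvd_add[OF _ pos] n])
  then show ?thesis by simp
qed

lemma prime_dvd_pcompose_diff_power:
  fixes g w :: "int poly"
  assumes "prime p" "of_nat p dvd w - [:0, 1:] ^ p"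
  shows "of_nat p dvd g \<circ>\<^sub>p w - g ^ p"
proof (induction g)
  case 0
  then show ?case using assms(1) prime_gt_0_nat[of p] by (simp add: power_0_left)
next
  case (pCons a h)
  have g: "pCons a h = [:a:] + [:0, 1:] * h" by simp
  have 1: "of_nat p dvd (w - [:0, 1:] ^ p) * (h \<circ>\<^sub>p w)" using assms(2) by simp
  have 2: "of_nat p dvd [:0, 1:] ^ p * (h \<circ>\<^sub>p w - h ^ p)" using pCons.IH by simp
  have 3: "of_nat p dvd ([:a:] + [:0, 1:] * h) ^ p - [:a:] ^ p - ([:0, 1:] * h) ^ p"
    by (rule prime_dvd_power_add) fact
  have "of_nat p dvd [:a ^ p - a:]"
    using prime_dvd_int_power_diff[OF assms(1), of a] by (simp add: of_nat_poly)
  then have 4: "of_nat p dvd [:a:] ^ p - [:a:]"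
    by (simp add: poly_const_pow)
  \<comment> \<open>The difference telescopes: replace \<open>w\<close> by X^p, then
    \<open>h(w)\<close> by \<open>h^p\<close>, then use additivity of Frobenius, and finally Fermat
    for the constant term.\<close>
  have "pCons a h \<circ>\<^sub>p w - pCons a h ^ p = (w - [:0, 1:] ^ p) * (h \<circ>\<^sub>p w) + [:0, 1:] ^ p * (h \<circ>\<^sub>p w - h ^ p)
     - (([:a:] + [:0, 1:] * h) ^ p - [:a:] ^ p - ([:0, 1:] * h) ^ p) - ([:a:] ^ p - [:a:])"
    unfolding pcompose_pCons power_mult_distrib g[symmetric] by (simp only: algebra_simps)
  also have "of_nat p dvd \<dots>"
    by (intro dvd_add dvd_diff 1 2 3 4)
  finally show ?case .
qed

section \<open>Integrality forces small remainders to vanish\<close>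

lemma int_poly_small_values_imp_zero:
  fixes A :: "complex set"
  assumes fin: "finite A"
  shows "\<exists>c>0. \<forall>h :: int poly. degree h < card A \<longrightarrow>
           (\<forall>z\<in>A. norm (poly (of_int_poly h) z) < c) \<longrightarrow> h = 0"
proof -
  \<comment> \<open>The Lagrange basis bounds the coefficients of h by its values on A.\<close>
  define L where "L z = (\<Prod>w\<in>A - {z}. smult (1 / (z - w)) [:- w, 1:])" for z :: complex
  have L: "poly (L z) y = (if y = z then 1 else 0)" if "z \<in> A" "y \<in> A" for z y
    using that fin by (auto simp: L_def poly_prod diff_divide_distrib[symmetric])
  have degL: "degree (L z) < card A" if "z \<in> A" for z
  proof -
    have "degree (L z) \<le> sum (degree \<circ> (\<lambda>w. smult (1 / (z - w)) [:- w, 1:])) (A - {z})"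
      unfolding L_def using fin by (intro degree_prod_sum_le) auto
    also have "\<dots> \<le> (\<Sum>w\<in>A - {z}. 1)"
      by (intro sum_mono) auto
    also have "\<dots> < card A"
      using card_Diff1_less[OF fin that] by (simp only: card_eq_sum)
    finally show ?thesis .
  qed
  \<comment> \<open>Chosen so that \<open>c\<close> times the sum of all Lagrange coefficient norms
    is below 1: an integer coefficient of absolute value below 1 is 0.\<close>
  define c where "c = 1 / (1 + (\<Sum>i<card A. \<Sum>z\<in>A. norm (coeff (L z) i)))"
  have S: "0 \<le> (\<Sum>i<card A. \<Sum>z\<in>A. norm (coeff (L z) i))"
    by (intro sum_nonneg) auto
  have c: "c > 0" using S by (simp add: c_def)
  have "h = 0" if deg: "degree h < card A" and small: "\<And>z. z \<in> A \<Longrightarrow> norm (poly (of_int_poly h) z) < c" for h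
  proof (rule poly_eqI)
    fix i
    define H where "H = (of_int_poly h :: complex poly)"
    have "degree H < card A" using deg by (simp add: H_def)
    moreover have "degree (\<Sum>z\<in>A. smult (poly H z) (L z)) < card A"
      using deg by (intro degree_sum_less le_less_trans[OF degree_smult_le] degL) auto
    moreover have "poly H y = poly (\<Sum>z\<in>A. smult (poly H z) (L z)) y" if "y \<in> A" for y
    proof -
      have "poly (\<Sum>z\<in>A. smult (poly H z) (L z)) y = (\<Sum>z\<in>A. if z = y then poly H z else 0)"
        unfolding poly_sum poly_smult using that by (intro sum.cong) (auto simp: L)
      also have "\<dots> = poly H y" using that fin by simp
      finally show ?thesis ..
    qed
    ultimately have H: "H = (\<Sum>z\<in>A. smult (poly H z) (L z))"
      by (intro poly_eqI_degree[where A = A]) auto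
    show "coeff h i = coeff 0 i"
    proof (cases "i < card A")
      case False
      then show ?thesis using deg by (simp add: coeff_eq_0)
    next
      case True
      have "coeff H i = (\<Sum>z\<in>A. poly H z * coeff (L z) i)"
        by (subst H) (simp add: coeff_sum)
      then have "norm (coeff H i) \<le> (\<Sum>z\<in>A. norm (poly H z * coeff (L z) i))"
        by (simp add: norm_sum)
      also have "\<dots> \<le> (\<Sum>z\<in>A. c * norm (coeff (L z) i))"
        using small by (intro sum_mono) (auto simp: norm_mult H_def less_imp_le intro!: mult_right_mono)
      also have "\<dots> = c * (\<Sum>z\<in>A. norm (coeff (L z) i))"
        by (simp add: sum_distrib_left)
      also have "\<dots> \<le> c * (\<Sum>i<card A. \<Sum>z\<in>A. norm (coeff (L z) i))"
        using c True by (intro mult_left_mono member_le_sum) (auto intro: sum_nonneg)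
      also have "\<dots> < 1" using S by (simp add: c_def)
      finally show ?thesis by (simp add: H_def)
    qed
  qed
  with c show ?thesis by blast
qed

lemma norm_poly_le_on_disc:
  fixes f :: "complex poly"
  assumes "norm z \<le> R"
  shows "norm (poly f z) \<le> (\<Sum>i\<le>degree f. norm (coeff f i) * R ^ i)"
  unfolding poly_altdef
  by (intro order_trans[OF norm_sum] sum_mono) (auto simp: norm_mult norm_power intro!: mult_left_mono power_mono assms)

text \<open>Pseudo-division multiplies by a power of the leading coefficient, here 1, so it is true
  division over the integers.\<close>

lemma monic_int_poly_divmod:
  fixes f g :: "int poly"
  assumes "lead_coeff g = 1"
  obtains u v where "f = g * u + v" "v = 0 \<or> degree v < degree g"
proof -
  obtain u v where uv: "pseudo_divmod f g = (u, v)" by force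
  have "g \<noteq> 0" using assms by auto
  from pseudo_divmod[OF this uv] assms that show ?thesis by simp
qed

text \<open>Here \<open>g\<close> is taken in the variable t + 1/t. The hypothesis
  \<open>simple\<close> supplies as many interpolation nodes as the degree of \<open>g\<close>, so a
  remainder modulo \<open>g\<close> is determined by its values at the roots.\<close>

lemma large_primes_permute_roots:
  fixes g :: "int poly"
  assumes monic: "lead_coeff g = 1"
    and simple: "card {z :: complex. poly (of_int_poly g) z = 0} = degree g"
    and circle: "\<And>z :: complex. poly (of_int_poly g) z = 0 \<Longrightarrow> \<exists>t. norm t = 1 \<and> z = t + 1 / t"
  shows "\<exists>p0. \<forall>p\<ge>p0. prime p \<longrightarrow> (\<forall>t :: complex. norm t = 1 \<longrightarrow>
           poly (of_int_poly g) (t + 1 / t) = 0 \<longrightarrow> poly (of_int_poly g) (t ^ p + 1 / t ^ p) = 0)"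
proof -
  define G where "G = (of_int_poly g :: complex poly)"
  define A where "A = {z. poly G z = 0}"
  have "G \<noteq> 0" using monic by (auto simp: G_def)
  then have fin: "finite A" unfolding A_def by (rule poly_roots_finite)
  have cardA: "card A = degree g" using simple by (simp add: A_def G_def)
  obtain c where c: "c > 0" and zero: "\<And>h :: int poly. degree h < card A \<Longrightarrow>
       (\<And>z. z \<in> A \<Longrightarrow> norm (poly (of_int_poly h) z) < c) \<Longrightarrow> h = 0"
    using int_poly_small_values_imp_zero[OF fin] by blast
  define M where "M = (\<Sum>i\<le>degree G. norm (coeff G i) * 2 ^ i)"
  \<comment> \<open>Guarantees p > 2, hence p odd, and M < p c.\<close>
  define p0 where "p0 = Suc (max 2 (nat \<lceil>M / c\<rceil>))"
  have "poly G (t ^ p + 1 / t ^ p) = 0"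
    if p: "p \<ge> p0" "prime p" and t: "norm t = 1" and root: "poly G (t + 1 / t) = 0" for p t
  proof -
    have p2: "p > 2" and pM: "M < p * c"
    proof -
      show "p > 2" using p(1) by (simp add: p0_def)
      have "M / c < p" using p(1) unfolding p0_def by linarith
      then show "M < p * c" using c by (simp add: field_simps)
    qed
    have "odd p" using p2 p(2) prime_odd_nat by blast
    obtain H where "g \<circ>\<^sub>p dickson p - g ^ p = of_nat p * H"
      using prime_dvd_pcompose_diff_power[OF p(2) prime_dvd_dickson_diff[OF p(2) \<open>odd p\<close>], of g]
      by (auto elim!: dvdE[of "of_nat p"])
    then have H: "g \<circ>\<^sub>p dickson p = g ^ p + of_nat p * H" by (simp add: algebra_simps)
    obtain u v where uv: "H = g * u + v" and v: "v = 0 \<or> degree v < degree g"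
      using monic_int_poly_divmod[OF monic] by metis
    \<comment> \<open>At a root of \<open>g\<close> both \<open>g ^ p\<close> and
      \<open>g * u\<close> vanish, so only p times the remainder \<open>v\<close> is left of
      g(D_p).\<close>
    have key: "poly G (\<tau> ^ p + 1 / \<tau> ^ p) = of_nat p * poly (of_int_poly v) (\<tau> + 1 / \<tau>)"
      if \<tau>: "norm \<tau> = 1" "poly G (\<tau> + 1 / \<tau>) = 0" for \<tau>
    proof -
      have "\<tau> \<noteq> 0" using \<tau> by auto
      then have "poly G (\<tau> ^ p + 1 / \<tau> ^ p) = poly (of_int_poly (g \<circ>\<^sub>p dickson p)) (\<tau> + 1 / \<tau>)"
        by (simp add: of_int_hom.map_poly_pcompose poly_pcompose poly_dickson G_def power_one_over)
      also have "\<dots> = of_nat p * poly (of_int_poly v) (\<tau> + 1 / \<tau>)"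
        using \<tau>(2) p2 by (simp add: H uv hom_distribs G_def power_0_left)
      finally show ?thesis .
    qed
    have "v = 0"
    proof (rule ccontr)
      assume "v \<noteq> 0"
      then have "degree v < card A" using v cardA by auto
      moreover have "norm (poly (of_int_poly v) z) < c" if "z \<in> A" for z
      proof -
        from that circle obtain \<tau> where \<tau>: "norm \<tau> = 1" "z = \<tau> + 1 / \<tau>" "poly G (\<tau> + 1 / \<tau>) = 0"
          unfolding A_def G_def by blast
        \<comment> \<open>The point stays in the disc of radius 2 for every p, so \<open>M\<close>
          does not depend on p and the value of \<open>v\<close> is at most M / p < c.\<close>
        have "norm (\<tau> ^ p + 1 / \<tau> ^ p) \<le> 2"
          using \<tau> by (intro order_trans[OF norm_triangle_ineq]) (simp add: norm_power norm_divide)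
        then have "norm (poly G (\<tau> ^ p + 1 / \<tau> ^ p)) \<le> M"
          unfolding M_def by (rule norm_poly_le_on_disc)
        also have "M < p * c" by fact
        finally show ?thesis
          unfolding key[OF \<tau>(1,3)] \<tau>(2) using p2 by (simp add: norm_mult)
      qed
      ultimately show False using zero \<open>v \<noteq> 0\<close> by blast
    qed
    with key[OF t root] show ?thesis by simp
  qed
  then show ?thesis unfolding G_def by blast
qed

section \<open>Sets of unimodular numbers closed under large prime powers\<close>

text \<open>Pigeonhole: for a single large prime p the powers t^(p^j) all lie in the finite set, so
  two of them coincide.\<close>

lemma root_of_unity_if_power_closed:
  fixes T :: "complex set"
  assumes "finite T" "0 \<notin> T" "\<And>p t. p \<ge> p0 \<Longrightarrow> prime p \<Longrightarrow> t \<in> T \<Longrightarrow> t ^ p \<in> T" "t \<in> T"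
  shows "\<exists>n>0. t ^ n = 1"
proof -
  obtain p where p: "prime p" "p > p0" using bigger_prime by blast
  have mem: "t ^ (p ^ j) \<in> T" for j
  proof (induction j)
    case (Suc j)
    then have "(t ^ (p ^ j)) ^ p \<in> T" using assms(3) p by auto
    then show ?case by (simp add: power_mult[symmetric] mult.commute)
  qed (use assms(4) in simp)
  have "\<not> inj (\<lambda>j. t ^ (p ^ j))"
    using mem assms(1) finite_subset[of "range (\<lambda>j. t ^ (p ^ j))" T] finite_imageD[of "\<lambda>j. t ^ (p ^ j)" UNIV]
    by (auto simp: image_subset_iff)
  then obtain i j where "i \<noteq> j" "t ^ (p ^ i) = t ^ (p ^ j)" by (auto simp: inj_on_def)
  then obtain i j where ij: "i < j" "t ^ (p ^ i) = t ^ (p ^ j)"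
    by (metis linorder_neqE_nat)
  have lt: "p ^ i < p ^ j" using ij(1) p(1) prime_gt_1_nat power_strict_increasing by blast
  have "t \<noteq> 0" using assms(2,4) by auto
  have "t ^ (p ^ j) = t ^ (p ^ i) * t ^ (p ^ j - p ^ i)"
    using lt by (simp flip: power_add)
  then have "t ^ (p ^ j - p ^ i) = 1" using ij(2) \<open>t \<noteq> 0\<close> by simp
  then show ?thesis using lt by (intro exI[of _ "p ^ j - p ^ i"]) simp
qed

text \<open>An elementary substitute for Dirichlet's theorem. Take \<open>m\<close> to be the
  product of the primes below \<open>B\<close> not dividing \<open>a\<close>: every prime below
  \<open>B\<close> then divides exactly one of \<open>a\<close> and \<open>n * m\<close>, hence not
  their sum.\<close>

lemma ex_cong_without_small_prime_factors:
  fixes a n B :: nat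
  assumes "gcd a n = 1" "a > 0"
  shows "\<exists>m. \<forall>p. prime p \<longrightarrow> p dvd a + n * m \<longrightarrow> p \<ge> B"
proof -
  define m where "m = (\<Prod>p | prime p \<and> p < B \<and> \<not> p dvd a. p)"
  have "p \<ge> B" if p: "prime p" "p dvd a + n * m" for p
  proof (rule ccontr)
    assume "\<not> p \<ge> B"
    show False
    proof (cases "p dvd a")
      case False
      then have "p dvd m"
        unfolding m_def using p \<open>\<not> p \<ge> B\<close> by (intro dvd_prodI) auto
      with p(2) False show False using dvd_add_left_iff[of p "n * m" a] by auto
    next
      case True
      then have "p dvd n * m" using p(2) dvd_add_right_iff by blast
      moreover have "\<not> p dvd n" using True assms(1) p(1) by (metis gcd_greatest not_prime_unit)
      ultimately have "p dvd m" using p(1) prime_dvd_mult_iff by blast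
      then obtain q' where q': "prime q'" "\<not> q' dvd a" "p dvd q'"
        unfolding m_def using prime_dvd_prod_iff[of "{p. prime p \<and> p < B \<and> \<not> p dvd a}" p "\<lambda>x. x"] p(1) by auto
      then have "p = q'" using p(1) primes_dvd_imp_eq by blast
      with q'(2) True show False by simp
    qed
  qed
  then show ?thesis by blast
qed

lemma power_mem_if_large_prime_factors:
  fixes T :: "complex set"
  assumes closed: "\<And>p t. p \<ge> p0 \<Longrightarrow> prime p \<Longrightarrow> t \<in> T \<Longrightarrow> t ^ p \<in> T"
    and "t \<in> T" "a > 0" "\<And>p. prime p \<Longrightarrow> p dvd a \<Longrightarrow> p \<ge> p0"
  shows "t ^ a \<in> T"
  using assms(3,4)
proof (induction a rule: less_induct)
  case (less a)
  show ?case
  proof (cases "a = 1")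
    case False
    then obtain p where p: "prime p" "p dvd a" using prime_factor_nat by blast
    then obtain b where b: "a = p * b" by (elim dvdE)
    have "t ^ b \<in> T"
      using less b p(1) prime_gt_1_nat[of p] by (intro less.IH) auto
    then have "(t ^ b) ^ p \<in> T" using closed less.prems(2) p by blast
    then show ?thesis by (simp add: b power_mult[symmetric] mult.commute)
  qed (use assms(2) in simp)
qed

text \<open>Since t^n = 1, the exponent \<open>a\<close> may be replaced by
  \<open>a + n * m\<close>, whose prime factors are all large.\<close>

lemma coprime_power_mem:
  fixes T :: "complex set"
  assumes closed: "\<And>p t. p \<ge> p0 \<Longrightarrow> prime p \<Longrightarrow> t \<in> T \<Longrightarrow> t ^ p \<in> T"
    and "t \<in> T" "t ^ n = 1" "gcd a n = 1" "a > 0"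
  shows "t ^ a \<in> T"
proof -
  obtain m where m: "\<And>p. prime p \<Longrightarrow> p dvd a + n * m \<Longrightarrow> p \<ge> p0"
    using ex_cong_without_small_prime_factors[OF assms(4,5), of p0] by blast
  have "t ^ (a + n * m) \<in> T"
    using assms(2,5) m by (intro power_mem_if_large_prime_factors[OF closed]) auto
  then show ?thesis by (simp add: power_add power_mult assms(3))
qed

section \<open>Eliminating t^N from two equations\<close>

lemma eliminate_multiplier_square:
  fixes u a b a' b' :: "'a :: comm_ring_1"
  assumes "u * a + b = 0" "u ^ 2 * a' + b' = 0"
  shows "b ^ 2 * a' + a ^ 2 * b' = 0"
proof -
  have b: "b = - (u * a)" using assms(1) by (simp add: eq_neg_iff_add_eq_0 add.commute)
  have "b ^ 2 * a' + a ^ 2 * b' = a ^ 2 * (u ^ 2 * a' + b')"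
    by (simp add: b power_mult_distrib algebra_simps)
  then show ?thesis by (simp add: assms(2))
qed

text \<open>The numerator of q_k in the variable t, see \<open>spider_eq_q\<close>.\<close>

definition spider :: "nat \<Rightarrow> complex \<Rightarrow> complex" where
  "spider N t = t ^ N * (t ^ 3 - t ^ 2 - t - 1) + (t ^ 3 + t ^ 2 + t - 1)"

text \<open>With u = t^N, the equations at t and t^2 involve u and u^2. Eliminating u leaves a
  polynomial independent of N, and its factorization gives the two alternatives.\<close>

lemma spider_square:
  assumes "spider N t = 0" "spider N (t ^ 2) = 0"
  shows "t ^ 4 = 1 \<or> t ^ 2 + t + 1 = 0"
proof -
  define u where "u = t ^ N"
  have u2: "(t ^ 2) ^ N = u ^ 2" by (simp add: u_def flip: power_mult) (simp add: mult.commute)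
  have 1: "u * (t ^ 3 - t ^ 2 - t - 1) + (t ^ 3 + t ^ 2 + t - 1) = 0"
    using assms(1) by (simp add: spider_def u_def)
  have 2: "u ^ 2 * ((t ^ 2) ^ 3 - (t ^ 2) ^ 2 - t ^ 2 - 1) + ((t ^ 2) ^ 3 + (t ^ 2) ^ 2 + t ^ 2 - 1) = 0"
    using assms(2) unfolding spider_def u2 .
  have "2 * ((t - 1) ^ 3 * (t + 1) * (t ^ 2 + t + 1) ^ 2 * (t ^ 2 + 1) ^ 2) = (t ^ 3 + t ^ 2 + t - 1) ^ 2 * ((t ^ 2) ^ 3 - (t ^ 2) ^ 2 - t ^ 2 - 1) + (t ^ 3 - t ^ 2 - t - 1) ^ 2 * ((t ^ 2) ^ 3 + (t ^ 2) ^ 2 + t ^ 2 - 1)"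
    by (simp add: algebra_simps eval_nat_numeral)
  also have "\<dots> = 0"
    using 1 2 by (intro eliminate_multiplier_square[of u]) (simp_all add: algebra_simps)
  finally have "2 * ((t - 1) ^ 3 * (t + 1) * (t ^ 2 + t + 1) ^ 2 * (t ^ 2 + 1) ^ 2) = 0" .
  then have "(t - 1) * (t + 1) * (t ^ 2 + 1) * (t ^ 2 + t + 1) = 0" by auto
  moreover have "(t - 1) * (t + 1) * (t ^ 2 + 1) = t ^ 4 - 1" by (simp add: algebra_simps eval_nat_numeral)
  ultimately show ?thesis by auto
qed

text \<open>For odd N the equations at t and -t are both linear in u = t^N, with opposite signs of
  u; cross-multiplication removes u.\<close>

lemma spider_minus:
  assumes "odd N" "spider N t = 0" "spider N (- t) = 0"
  shows "t ^ 4 = 1"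
proof -
  define u where "u = t ^ N"
  have u2: "(- t) ^ N = - u" using assms(1) by (simp add: u_def)
  have 1: "u * (t ^ 3 - t ^ 2 - t - 1) + (t ^ 3 + t ^ 2 + t - 1) = 0"
    using assms(2) by (simp add: spider_def u_def)
  have 2: "- u * ((- t) ^ 3 - (- t) ^ 2 - (- t) - 1) + ((- t) ^ 3 + (- t) ^ 2 + (- t) - 1) = 0"
    using assms(3) unfolding spider_def u2 .
  have "2 * ((t ^ 4 - 1) * (t ^ 2 + 1)) =
      - (((- t) ^ 3 - (- t) ^ 2 - (- t) - 1) * (u * (t ^ 3 - t ^ 2 - t - 1) + (t ^ 3 + t ^ 2 + t - 1))
       + (t ^ 3 - t ^ 2 - t - 1) * (- u * ((- t) ^ 3 - (- t) ^ 2 - (- t) - 1) + ((- t) ^ 3 + (- t) ^ 2 + (- t) - 1)))"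
    by (simp add: algebra_simps eval_nat_numeral)
  also have "\<dots> = 0" unfolding 1 2 by simp
  finally have "2 * ((t ^ 4 - 1) * (t ^ 2 + 1)) = 0" .
  then have "t ^ 4 - 1 = 0 \<or> t ^ 2 + 1 = 0" by auto
  moreover have "t ^ 4 - 1 = (t ^ 2 - 1) * (t ^ 2 + 1)" by (simp add: algebra_simps eval_nat_numeral)
  ultimately show ?thesis by auto
qed

text \<open>The elimination of \<open>spider_square\<close> with a sign from odd N; this time an
  extra quartic factor survives.\<close>

lemma spider_minus_square:
  assumes "odd N" "t \<noteq> 0" "spider N t = 0" "spider N (- (t ^ 2)) = 0"
  shows "t ^ 4 = 1 \<or> 2 * t ^ 4 - t ^ 3 - t + 2 = 0"
proof -
  define u where "u = t ^ N"
  have u2: "(- (t ^ 2)) ^ N = - (u ^ 2)"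
    using assms(1) by (simp add: u_def flip: power_mult) (simp add: mult.commute)
  have 1: "u * (t ^ 3 - t ^ 2 - t - 1) + (t ^ 3 + t ^ 2 + t - 1) = 0"
    using assms(3) by (simp add: spider_def u_def)
  have 2: "- (u ^ 2) * ((- (t ^ 2)) ^ 3 - (- (t ^ 2)) ^ 2 - (- (t ^ 2)) - 1) + ((- (t ^ 2)) ^ 3 + (- (t ^ 2)) ^ 2 + (- (t ^ 2)) - 1) = 0"
    using assms(4) unfolding spider_def u2 .
  have "2 * (t * (t - 1) * (t + 1) ^ 3 * (t ^ 2 + 1) * (2 * t ^ 4 - t ^ 3 - t + 2)) = (t ^ 3 + t ^ 2 + t - 1) ^ 2 * (- ((- (t ^ 2)) ^ 3 - (- (t ^ 2)) ^ 2 - (- (t ^ 2)) - 1)) + (t ^ 3 - t ^ 2 - t - 1) ^ 2 * ((- (t ^ 2)) ^ 3 + (- (t ^ 2)) ^ 2 + (- (t ^ 2)) - 1)"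
    by (simp add: algebra_simps eval_nat_numeral)
  also have "\<dots> = 0"
    using 1 2 by (intro eliminate_multiplier_square[of u]) (simp_all add: algebra_simps)
  finally have "2 * (t * (t - 1) * (t + 1) ^ 3 * (t ^ 2 + 1) * (2 * t ^ 4 - t ^ 3 - t + 2)) = 0" .
  then have "(t - 1) * (t + 1) * (t ^ 2 + 1) * (2 * t ^ 4 - t ^ 3 - t + 2) = 0" using assms(2) by auto
  moreover have "(t - 1) * (t + 1) * (t ^ 2 + 1) = t ^ 4 - 1" by (simp add: algebra_simps eval_nat_numeral)
  ultimately show ?thesis by auto
qed

text \<open>
  The quartic left over in \<open>spider_minus_square\<close> does have roots on the unit circle; they are
  excluded because t and -t^2 cannot both be roots.
\<close>

lemma quartic_no_common_root:
  fixes t :: complex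
  assumes "2 * t ^ 4 - t ^ 3 - t + 2 = 0" "2 * (- (t ^ 2)) ^ 4 - (- (t ^ 2)) ^ 3 - (- (t ^ 2)) + 2 = 0"
  shows False
proof -
  have "t \<noteq> 0" using assms(1) by auto
  \<comment> \<open>The quartic is self-reciprocal, hence quadratic in s = t + 1/t, and passing from
    t to -t^2 sends s to 2 - s^2.\<close>
  define s where "s = t + 1 / t"
  have s1: "s * t = t ^ 2 + 1" using \<open>t \<noteq> 0\<close> by (simp add: s_def distrib_right power2_eq_square)
  have "t ^ 2 * (2 * s ^ 2 - s - 4) = 2 * (s * t) ^ 2 - t * (s * t) - 4 * t ^ 2"
    by (simp add: algebra_simps eval_nat_numeral)
  also have "\<dots> = 2 * t ^ 4 - t ^ 3 - t + 2"
    unfolding s1 by (simp add: algebra_simps eval_nat_numeral)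
  finally have "2 * s ^ 2 - s - 4 = 0" using \<open>t \<noteq> 0\<close> assms(1) by simp
  then have a: "2 * s ^ 2 = s + 4" by (simp add: algebra_simps)
  have "t ^ 4 * (2 * (2 - s ^ 2) ^ 2 - (2 - s ^ 2) - 4)
      = 2 * (2 * t ^ 2 - (s * t) ^ 2) ^ 2 - t ^ 2 * (2 * t ^ 2 - (s * t) ^ 2) - 4 * t ^ 4"
    by (simp add: algebra_simps eval_nat_numeral)
  also have "\<dots> = 2 * (- (t ^ 2)) ^ 4 - (- (t ^ 2)) ^ 3 - (- (t ^ 2)) + 2"
    unfolding s1 by (simp add: algebra_simps eval_nat_numeral)
  finally have b: "2 * (2 - s ^ 2) ^ 2 - (2 - s ^ 2) - 4 = 0" using \<open>t \<noteq> 0\<close> assms(2) by simp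
  have "2 - s ^ 2 = - s / 2" using a by (simp add: field_simps)
  with b have "s ^ 2 + s = 8" by (simp add: field_simps)
  then have "s ^ 2 = 8 - s" by (simp add: algebra_simps)
  with a have "3 * (s - 4) = 0" by (simp add: algebra_simps)
  then have "s = 4" by simp
  with a show False by simp
qed

lemma spider_torsion:
  fixes T :: "complex set"
  assumes fin: "finite T" and nz: "0 \<notin> T"
    and closed: "\<And>p t. p \<ge> p0 \<Longrightarrow> prime p \<Longrightarrow> t \<in> T \<Longrightarrow> t ^ p \<in> T"
    and "odd N" and root: "\<And>t. t \<in> T \<Longrightarrow> spider N t = 0" and t: "t \<in> T"
  shows "t ^ 4 = 1 \<or> t ^ 2 + t + 1 = 0"
proof -
  define n where "n = (LEAST n. n > 0 \<and> t ^ n = 1)"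
  have ex: "\<exists>n. n > 0 \<and> t ^ n = 1"
    using root_of_unity_if_power_closed[OF fin nz closed t] by blast
  have n: "n > 0" "t ^ n = 1" using LeastI_ex[OF ex] by (auto simp: n_def)
  have least: "t ^ m \<noteq> 1" if "0 < m" "m < n" for m
    using not_less_Least[of m "\<lambda>n. n > 0 \<and> t ^ n = 1"] that by (auto simp: n_def)
  have mem: "t ^ a \<in> T" if "gcd a n = 1" "a > 0" for a
    using coprime_power_mem[OF closed t n(2) that] .
  have half: "t ^ m = -1" if "n = 2 * m" for m
  proof -
    have "(t ^ m) ^ 2 = 1" using n(2) that by (simp flip: power_mult add: mult.commute)
    moreover have "t ^ m \<noteq> 1" using least[of m] n(1) that by auto
    ultimately show ?thesis by (simp add: power2_eq_1_iff)
  qed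
  have "t \<noteq> 0" using t nz by auto
  \<comment> \<open>The exponents used are 2 for odd n, m + 2 and m + 4 for n = 2 m with m odd, and
    2 l + 1 for n = 4 l. Each is coprime to n, and t^(n/2) = -1 turns the latter ones into sign
    changes.\<close>
  have "odd n \<or> (\<exists>m. n = 2 * m \<and> odd m) \<or> (\<exists>l. n = 4 * l)" by presburger
  then consider "odd n" | m where "n = 2 * m" "odd m" | l where "n = 4 * l" by blast
  then show ?thesis
  proof cases
    case 1
    then have "gcd 2 n = 1" by (simp add: coprime_iff_gcd_eq_1[symmetric])
    then have "t ^ 2 \<in> T" by (intro mem) auto
    then show ?thesis using spider_square root t by blast
  next
    case (2 m)
    have g: "gcd (m + 2 ^ Suc e) n = 1" for e
    proof (rule ccontr)
      assume "gcd (m + 2 ^ Suc e) n \<noteq> 1"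
      then obtain p where p: "prime p" "p dvd gcd (m + 2 ^ Suc e) n" using prime_factor_nat by blast
      then have pd: "p dvd m + 2 ^ Suc e" "p dvd 2 * m" using 2 by auto
      have "odd (m + 2 ^ Suc e)" using 2 by simp
      then have "p \<noteq> 2" using pd by auto
      then have "\<not> p dvd 2" using p(1) primes_dvd_imp_eq two_is_prime_nat by blast
      then have "p dvd m" using pd(2) p(1) prime_dvd_mult_iff by blast
      then have "p dvd 2 ^ Suc e" using pd(1) dvd_add_right_iff by blast
      then show False using \<open>\<not> p dvd 2\<close> p(1) prime_dvd_power by blast
    qed
    \<comment> \<open>Two exponents are needed: writing -t^4 as the image of -t^2 under z \<mapsto>
      -z^2 lets the elimination run a second time, which disposes of the quartic.\<close>
    have "t ^ (m + 2) \<in> T" "t ^ (m + 4) \<in> T"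
      using mem[OF g[of 0]] mem[OF g[of 1]] by simp_all
    moreover have "t ^ (m + 2) = - (t ^ 2)" "t ^ (m + 4) = - ((- (t ^ 2)) ^ 2)"
      unfolding power_add half[OF 2(1)] by simp_all
    ultimately have "- (t ^ 2) \<in> T" and "- ((- (t ^ 2)) ^ 2) \<in> T"
      by metis+
    then have h: "spider N t = 0" "spider N (- (t ^ 2)) = 0" "spider N (- ((- (t ^ 2)) ^ 2)) = 0"
      using root t by blast+
    have "t ^ 4 = 1 \<or> 2 * t ^ 4 - t ^ 3 - t + 2 = 0"
      using spider_minus_square[OF \<open>odd N\<close> \<open>t \<noteq> 0\<close> h(1,2)] .
    moreover have "(- (t ^ 2)) ^ 4 = 1 \<or> 2 * (- (t ^ 2)) ^ 4 - (- (t ^ 2)) ^ 3 - (- (t ^ 2)) + 2 = 0"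
      using spider_minus_square[OF \<open>odd N\<close> _ h(2,3)] \<open>t \<noteq> 0\<close> by simp
    \<comment> \<open>Here t^8 = 1, while n = 2 m with m odd is 2 or 6 modulo 8; together these
      force t^2 = 1.\<close>
    moreover have "t ^ 4 = 1" if "(- (t ^ 2)) ^ 4 = 1"
    proof -
      have t8: "t ^ 8 = 1" using that by (simp flip: power_mult)
      have "\<exists>k. m = 4 * k + 1 \<or> m = 4 * k + 3" using \<open>odd m\<close> by presburger
      then obtain k where "m = 4 * k + 1 \<or> m = 4 * k + 3" by blast
      then have "n = 8 * k + 2 \<or> n = 8 * k + 6" using 2(1) by auto
      moreover have "t ^ (8 * k + 2) = t ^ 2" "t ^ (8 * k + 6) = t ^ 6"
        unfolding power_add power_mult t8 by simp_all
      ultimately have "t ^ 2 = 1 \<or> t ^ 6 = 1" using n(2) by metis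
      then show ?thesis
      proof
        assume "t ^ 6 = 1"
        then have "t ^ 2 = 1" using t8 power_add[of t 6 2] by simp
        then show ?thesis using power_mult[of t 2 2] by simp
      qed (use power_mult[of t 2 2] in simp)
    qed
    ultimately show ?thesis using quartic_no_common_root by blast
  next
    case (3 l)
    have "gcd (2 * l + 1) n = 1"
    proof (rule ccontr)
      assume "gcd (2 * l + 1) n \<noteq> 1"
      then obtain p where p: "prime p" "p dvd gcd (2 * l + 1) n" using prime_factor_nat by blast
      then have pd: "p dvd 2 * l + 1" "p dvd 2 * (2 * l)" using 3 by auto
      have "p \<noteq> 2" using pd(1) by auto
      then have "\<not> p dvd 2" using p(1) primes_dvd_imp_eq two_is_prime_nat by blast
      then have "p dvd 2 * l" using pd(2) p(1) prime_dvd_mult_iff by blast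
      then have "p dvd 1" using pd(1) dvd_add_right_iff by blast
      then show False using p(1) by simp
    qed
    then have "t ^ (2 * l + 1) \<in> T" by (intro mem) auto
    then have "- t \<in> T" using half[of "2 * l"] 3 by (simp add: power_add)
    then show ?thesis using spider_minus[OF \<open>odd N\<close>] root t by blast
  qed
qed

section \<open>The roots of q\<close>

text \<open>
  Interpolates the q_k by a three-term recurrence with linear coefficients; the initial values are
  those obtained by running the recurrence backwards from \<open>chain_eq_q\<close>.
\<close>

fun chain :: "'a :: comm_ring_1 \<Rightarrow> nat \<Rightarrow> 'a" where
  "chain s 0 = s + 2"
| "chain s (Suc 0) = s"
| "chain s (Suc (Suc n)) = s * chain s (Suc n) - chain s n"

lemma chain_step_two:
  "chain s (Suc (Suc (Suc (Suc n)))) = (s ^ 2 - 2) * chain s (Suc (Suc n)) - chain s n"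
  by (simp add: algebra_simps power2_eq_square)

lemma poly_q_base:
  fixes x :: "'a :: field_char_0"
  shows "poly (of_int_poly (q 0)) x = x ^ 2 - 5 * x + 3"
  "poly (of_int_poly (q (Suc 0))) x = (x ^ 3 - 8 * x ^ 2 + 17 * x - 5) * (x - 1)"
proof -
  have eqs: "poly (of_int_poly [:-5, 17, -8, 1:]) x = x ^ 3 - 8 * x ^ 2 + 17 * x - 5"
    "poly (of_int_poly [:-1, 1:]) x = x - 1"
    by (simp_all add: map_poly_pCons map_poly_1 algebra_simps power2_eq_square power3_eq_cube)
  show "poly (of_int_poly (q (Suc 0))) x = (x ^ 3 - 8 * x ^ 2 + 17 * x - 5) * (x - 1)"
    unfolding q.simps(2) of_int_poly_hom.hom_mult poly_mult eqs ..
qed (simp add: map_poly_pCons map_poly_1 algebra_simps power2_eq_square)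

lemma poly_q_rec:
  fixes x :: "'a :: field_char_0"
  shows "poly (of_int_poly (q (Suc (Suc k)))) x =
     (x ^ 2 - 4 * x + 2) * poly (of_int_poly (q (Suc k))) x - poly (of_int_poly (q k)) x"
proof -
  have eq: "poly (of_int_poly [:2, -4, 1:]) x = x ^ 2 - 4 * x + 2"
    by (simp add: map_poly_pCons map_poly_1 algebra_simps power2_eq_square)
  show ?thesis
    unfolding q.simps(3) of_int_poly_hom.hom_minus of_int_poly_hom.hom_mult poly_diff poly_mult eq ..
qed

text \<open>With x = s + 2 the two-step multiplier s^2 - 2 is x^2 - 4 x + 2, so the odd-indexed
  terms obey the recurrence of \<open>q\<close>. The factor s only adds the root x = 2.\<close>

lemma chain_eq_q:
  fixes s :: "'a :: field_char_0"
  shows "chain s (2 * k + 3) = s * poly (of_int_poly (q k)) (s + 2)"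
proof (induction k rule: q.induct)
  case (3 k)
  have "chain s (2 * Suc (Suc k) + 3) = (s ^ 2 - 2) * chain s (2 * Suc k + 3) - chain s (2 * k + 3)"
    using chain_step_two[of s "2 * k + 3"] by (simp add: eval_nat_numeral)
  also have "s ^ 2 - 2 = (s + 2) ^ 2 - 4 * (s + 2) + 2"
    by (simp add: algebra_simps power2_eq_square)
  finally show ?case
    unfolding 3 poly_q_rec by (simp only: right_diff_distrib mult_ac)
qed (simp_all only: poly_q_base, simp_all add: algebra_simps eval_nat_numeral)

text \<open>At n = 0 the left side is a (b + 2) - (a + 2) b = 2 (a - b); this positive constant 2
  stands in for the term of index 0.\<close>

lemma chain_christoffel_darboux:
  "chain a (Suc n) * chain b n - chain a n * chain b (Suc n)
     = (a - b) * (2 + (\<Sum>i=1..n. chain a i * chain b i))"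
proof (induction n)
  case (Suc n)
  have "chain a (Suc (Suc n)) * chain b (Suc n) - chain a (Suc n) * chain b (Suc (Suc n))
      = (a - b) * (chain a (Suc n) * chain b (Suc n))
        + (chain a (Suc n) * chain b n - chain a n * chain b (Suc n))"
    by (simp add: algebra_simps)
  then show ?case unfolding Suc by (simp add: algebra_simps)
qed (simp add: algebra_simps)

section \<open>Reality, simplicity and location of the roots\<close>

lemma cnj_chain: "cnj (chain a n) = chain (cnj a) n"
  by (induction a n rule: chain.induct) simp_all

lemma of_real_chain: "chain (complex_of_real a) n = of_real (chain a n)"
  by (induction a n rule: chain.induct) simp_all

lemma chain_root_real:
  fixes a :: complex
  assumes "chain a n = 0"
  shows "a \<in> \<real>"
proof -
  \<comment> \<open>Christoffel--Darboux at the pair a, cnj a.\<close>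
  define S where "S = (\<Sum>i=1..n. (cmod (chain a i))\<^sup>2)"
  have "S \<ge> 0" unfolding S_def by (intro sum_nonneg) auto
  have "(\<Sum>i=1..n. chain a i * chain (cnj a) i) = of_real S"
    by (simp add: S_def cnj_chain[symmetric] complex_norm_square del: of_real_power)
  moreover have "chain (cnj a) n = 0" using assms cnj_chain[of a n] by simp
  ultimately have "(a - cnj a) * of_real (2 + S) = 0"
    using chain_christoffel_darboux[of a n "cnj a"] assms by simp
  moreover have "complex_of_real (2 + S) \<noteq> 0" using \<open>S \<ge> 0\<close> by (simp only: of_real_eq_0_iff)
  ultimately show ?thesis by (simp add: Reals_cnj_iff)
qed

lemma poly_chain: "poly (chain [:0, 1:] n) a = chain a n"
  by (induction "[:0, 1 :: 'a:]" n rule: chain.induct) (simp_all add: numeral_poly)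

text \<open>The confluent case b = a of Christoffel--Darboux, proved directly for polynomials. At a
  real argument the right side is at least 2, which rules out double roots.\<close>

lemma pderiv_chain:
  fixes n :: nat
  defines "P \<equiv> \<lambda>n. chain [:0, 1 :: 'a :: idom:] n"
  shows "pderiv (P (Suc n)) * P n - pderiv (P n) * P (Suc n) = 2 + (\<Sum>i=1..n. (P i)\<^sup>2)"
proof (induction n)
  case 0
  then show ?case by (simp add: P_def numeral_poly pderiv_add pderiv_pCons)
next
  case (Suc n)
  have d1: "pderiv (P (Suc (Suc n))) = P (Suc n) + [:0, 1:] * pderiv (P (Suc n)) - pderiv (P n)"
    by (simp add: P_def pderiv_diff pderiv_mult pderiv_pCons del: mult_pCons_left)
  have d2: "P (Suc (Suc n)) = [:0, 1:] * P (Suc n) - P n"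
    by (simp add: P_def)
  have "pderiv (P (Suc (Suc n))) * P (Suc n) - pderiv (P (Suc n)) * P (Suc (Suc n))
      = (P (Suc n))\<^sup>2 + (pderiv (P (Suc n)) * P n - pderiv (P n) * P (Suc n))"
    by (subst d1, subst d2) (simp only: algebra_simps power2_eq_square)
  then show ?case unfolding Suc by simp
qed

lemma chain_root_simple:
  fixes a :: complex
  assumes "chain a n = 0"
  shows "poly (pderiv (chain [:0, 1:] n)) a \<noteq> 0"
proof
  assume der: "poly (pderiv (chain [:0, 1:] n)) a = 0"
  obtain x where x: "a = of_real x" using chain_root_real[OF assms] by (elim Reals_cases)
  have "poly (2 + (\<Sum>i=1..n. (chain [:0, 1:] i)\<^sup>2)) a = 0"
    unfolding pderiv_chain[symmetric] poly_diff poly_mult poly_chain der assms by simp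
  then have "complex_of_real (2 + (\<Sum>i=1..n. (chain x i)\<^sup>2)) = 0"
    unfolding poly_add poly_sum poly_power poly_chain by (simp add: x of_real_chain)
  then have "2 + (\<Sum>i=1..n. (chain x i)\<^sup>2) = 0"
    by (simp only: of_real_eq_0_iff)
  moreover have "(\<Sum>i=1..n. (chain x i)\<^sup>2) \<ge> 0" by (intro sum_nonneg) auto
  ultimately show False by linarith
qed

text \<open>For |a| at least 2 the recurrence makes absolute values grow once they have started to;
  the start needs a \<le> -2. Hence no root has s \<le> -2, that is, x \<le> 0.\<close>

lemma abs_chain_less:
  fixes a :: real
  assumes "a \<le> -2"
  shows "\<bar>chain a n\<bar> < \<bar>chain a (Suc n)\<bar>"
proof (induction n)
  case 0
  then show ?case using assms by simp
next
  case (Suc n)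
  have "2 * \<bar>chain a (Suc n)\<bar> \<le> \<bar>a\<bar> * \<bar>chain a (Suc n)\<bar>"
    using assms by (intro mult_right_mono) auto
  also have "\<dots> \<le> \<bar>chain a (Suc (Suc n))\<bar> + \<bar>chain a n\<bar>"
    by (simp add: abs_mult[symmetric])
  finally show ?case using Suc by linarith
qed

lemma chain_pos_before_root:
  fixes a :: real
  assumes "a > 2" "chain a (Suc n) = 0" "i \<le> n"
  shows "chain a i > 0"
proof -
  \<comment> \<open>Once the sequence is nonpositive, it decreases strictly and never returns to 0.\<close>
  have alt: "(\<forall>i\<le>m. chain a i > 0) \<or> (chain a m \<le> 0 \<and> chain a (Suc m) < chain a m)" for m
  proof (induction m)
    case 0
    then show ?case using assms(1) by simp
  next
    case (Suc m)
    have le: "a * chain a (Suc m) \<le> 2 * chain a (Suc m)" if "chain a (Suc m) \<le> 0"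
      using that assms(1) by (intro mult_right_mono_neg) auto
    from Suc show ?case
    proof (elim disjE conjE)
      assume *: "\<forall>i\<le>m. chain a i > 0"
      then have "chain a m > 0" by simp
      then show ?thesis using le * by (cases "chain a (Suc m) > 0") (auto simp: le_Suc_eq)
    next
      assume *: "chain a m \<le> 0" "chain a (Suc m) < chain a m"
      then have "a * chain a (Suc m) \<le> 2 * chain a (Suc m)" by (intro le) simp
      then have "chain a (Suc (Suc m)) < chain a (Suc m)"
        unfolding chain.simps using * by linarith
      then show ?thesis using * by linarith
    qed
  qed
  from alt[of n] show ?thesis using assms by auto
qed

text \<open>At two such roots the left side of Christoffel--Darboux vanishes, while positivity of
  the earlier terms keeps the second factor on the right at least 2.\<close>

lemma chain_root_gt_2_unique:
  fixes a b :: real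
  assumes "a > 2" "b > 2" "chain a n = 0" "chain b n = 0"
  shows "a = b"
proof (cases n)
  case 0
  then show ?thesis using assms by simp
next
  case (Suc m)
  have "(\<Sum>i=1..m. chain a i * chain b i) \<ge> 0"
    using assms Suc by (intro sum_nonneg mult_nonneg_nonneg less_imp_le[OF chain_pos_before_root[where n = m]]) auto
  moreover have "(a - b) * (2 + (\<Sum>i=1..m. chain a i * chain b i)) = 0"
    using chain_christoffel_darboux[of a m b] assms Suc by simp
  ultimately show ?thesis by auto
qed

lemma poly_of_int_poly_of_real:
  "poly (of_int_poly f) (complex_of_real x) = of_real (poly (of_int_poly f) x)"
  by (induction f) (simp_all add: map_poly_pCons)

lemma q_root_real:
  fixes z :: complex
  assumes "poly (of_int_poly (q k)) z = 0"
  obtains x where "z = of_real x" "x > 0" "poly (of_int_poly (q k)) x = 0"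
proof -
  have c: "chain (z - 2) (2 * k + 3) = 0" using assms by (simp add: chain_eq_q)
  then obtain s where s: "z - 2 = of_real s" using chain_root_real by (blast elim: Reals_cases)
  then have z: "z = of_real (s + 2)" by (simp add: algebra_simps)
  have "chain s (2 * k + 3) = 0" using c by (simp add: s of_real_chain)
  moreover have "chain s (2 * k + 3) \<noteq> 0" if "s \<le> -2"
    using abs_chain_less[OF that, of "2 * k + 2"] by (auto simp: eval_nat_numeral)
  ultimately have "s > -2" by force
  have "poly (of_int_poly (q k)) (s + 2) = 0"
    using assms unfolding z poly_of_int_poly_of_real by (simp only: of_real_eq_0_iff)
  then show ?thesis using that[of "s + 2"] z \<open>s > -2\<close> by simp
qed

lemma q_root_simple:
  fixes z :: complex
  assumes "poly (of_int_poly (q k)) z = 0"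
  shows "poly (pderiv (of_int_poly (q k))) z \<noteq> 0"
proof
  assume der: "poly (pderiv (of_int_poly (q k))) z = 0"
  define Q where "Q = (of_int_poly (q k) :: complex poly)"
  have eq: "chain [:0, 1:] (2 * k + 3) = [:0, 1:] * (Q \<circ>\<^sub>p [:2, 1:])"
  proof (rule poly_ext)
    fix x
    show "poly (chain [:0, 1:] (2 * k + 3)) x = poly ([:0, 1:] * (Q \<circ>\<^sub>p [:2, 1:])) x"
      unfolding poly_chain chain_eq_q poly_mult poly_pcompose by (simp add: Q_def add.commute)
  qed
  have "poly (pderiv (chain [:0, 1:] (2 * k + 3))) (z - 2) = 0"
    using assms der
    unfolding eq pderiv_mult pderiv_pcompose poly_add poly_mult poly_pcompose Q_def[symmetric] by simp
  moreover have "chain (z - 2) (2 * k + 3) = 0" using assms by (simp add: chain_eq_q)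
  ultimately show False using chain_root_simple by blast
qed

lemma q_root_gt_4_unique:
  fixes x y :: real
  assumes "x > 4" "y > 4" "poly (of_int_poly (q k)) x = 0" "poly (of_int_poly (q k)) y = 0"
  shows "x = y"
  using chain_root_gt_2_unique[of "x - 2" "y - 2" "2 * k + 3"] assms by (simp add: chain_eq_q)

text \<open>The points 4, 0 and 2 are t + 1/t + 2 at the fourth roots of unity 1, -1 and
  \<plusminus>i. The negative value at 4 also places the largest root beyond 4.\<close>

lemma poly_q_4: "poly (q k) 4 = - (2 * int k + 1)"
  by (induction k rule: q.induct) simp_all

lemma poly_q_0: "poly (q k) 0 = 2 * int k + 3"
  by (induction k rule: q.induct) simp_all

lemma poly_q_2: "poly (q k) 2 = (-1) ^ Suc k * (2 * int k + 3)"
  by (induction k rule: q.induct) (simp_all add: algebra_simps)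

text \<open>At x = 1 the multiplier x^2 - 4 x + 2 is -1, so the values repeat -1, 0, 1 with period
  3.\<close>

lemma poly_q_1_eq_0_iff: "poly (q k) 1 = 0 \<longleftrightarrow> k mod 3 = 1"
proof -
  have base: "poly (q (3 * j)) 1 = -1 \<and> poly (q (Suc (3 * j))) 1 = 0" for j
  proof (induction j)
    case (Suc j)
    have eq: "3 * Suc j = Suc (Suc (Suc (3 * j)))" by simp
    show ?case unfolding eq using Suc by simp
  qed simp
  have "poly (q (Suc (Suc (3 * j)))) 1 = 1" for j
    using base[of j] by simp
  moreover have "\<exists>j. k = 3 * j \<or> k = Suc (3 * j) \<or> k = Suc (Suc (3 * j))" by presburger
  ultimately show ?thesis using base by (auto simp: mod_Suc)
qed

lemma q_monic: "degree (q k) = 2 * k + 2 \<and> lead_coeff (q k) = 1"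
proof (induction k rule: q.induct)
  case (3 k)
  have deg: "degree ([:2, -4, 1:] * q (Suc k)) = 2 * Suc (Suc k) + 2"
    using 3 by (subst degree_mult_eq) auto
  then have lt: "degree (q k) < degree ([:2, -4, 1:] * q (Suc k))" using 3 by simp
  have "degree (q (Suc (Suc k))) = degree ([:2, -4, 1:] * q (Suc k))"
    using degree_add_eq_left[of "- q k"] lt by simp
  moreover have "lead_coeff (q (Suc (Suc k))) = lead_coeff ([:2, -4, 1:] * q (Suc k))"
    using lead_coeff_add_le[of "- q k"] lt calculation by (simp add: coeff_eq_0)
  moreover have "lead_coeff ([:2, -4, 1:] * q (Suc k)) = 1"
    unfolding lead_coeff_mult 3(1)[THEN conjunct2] by simp
  ultimately show ?case using deg by metis
qed simp_all

text \<open>After scaling by t^2 the multiplier becomes t^4 + 1, so the recurrence has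
  characteristic roots t^4 and 1. This explains N = 4 k + 5 and the two fixed cubics.\<close>

lemma spider_eq_q:
  assumes "t \<noteq> 0"
  shows "spider (4 * k + 5) t = t ^ (2 * k + 2) * (t ^ 4 - 1) * poly (of_int_poly (q k)) (t + 1 / t + 2)"
proof -
  define x where "x = t + 1 / t + 2"
  have xt: "t * x = (t + 1) ^ 2"
    using assms by (simp add: x_def algebra_simps power2_eq_square)
  have "spider (4 * k + 5) t = t ^ (2 * k + 2) * (t ^ 4 - 1) * poly (of_int_poly (q k)) x"
  proof (induction k rule: q.induct)
    case 1
    have "t ^ 2 * (x ^ 2 - 5 * x + 3) = (t * x) ^ 2 - 5 * t * (t * x) + 3 * t ^ 2"
      by (simp add: algebra_simps power2_eq_square)
    also have "\<dots> = (t + 1) ^ 4 - 5 * t * (t + 1) ^ 2 + 3 * t ^ 2"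
      unfolding xt by simp
    finally have eq: "t ^ 2 * (x ^ 2 - 5 * x + 3) = (t + 1) ^ 4 - 5 * t * (t + 1) ^ 2 + 3 * t ^ 2" .
    have "t ^ 2 * (t ^ 4 - 1) * poly (of_int_poly (q 0)) x = (t ^ 4 - 1) * (t ^ 2 * (x ^ 2 - 5 * x + 3))"
      unfolding poly_q_base by (simp only: mult_ac)
    also have "\<dots> = (t ^ 4 - 1) * ((t + 1) ^ 4 - 5 * t * (t + 1) ^ 2 + 3 * t ^ 2)"
      unfolding eq ..
    also have "\<dots> = spider 5 t"
      by (simp add: spider_def algebra_simps eval_nat_numeral)
    finally show ?case by (simp del: q.simps add: power2_eq_square)
  next
    case 2
    have "t ^ 4 * ((x ^ 3 - 8 * x ^ 2 + 17 * x - 5) * (x - 1))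
        = ((t * x) ^ 3 - 8 * t * (t * x) ^ 2 + 17 * t ^ 2 * (t * x) - 5 * t ^ 3) * (t * x - t)"
      by (simp add: algebra_simps eval_nat_numeral)
    also have "\<dots> = ((t + 1) ^ 6 - 8 * t * (t + 1) ^ 4 + 17 * t ^ 2 * (t + 1) ^ 2 - 5 * t ^ 3) * ((t + 1) ^ 2 - t)"
      unfolding xt by simp
    finally have eq: "t ^ 4 * ((x ^ 3 - 8 * x ^ 2 + 17 * x - 5) * (x - 1))
        = ((t + 1) ^ 6 - 8 * t * (t + 1) ^ 4 + 17 * t ^ 2 * (t + 1) ^ 2 - 5 * t ^ 3) * ((t + 1) ^ 2 - t)" .
    have "t ^ 4 * (t ^ 4 - 1) * poly (of_int_poly (q (Suc 0))) x
        = (t ^ 4 - 1) * (t ^ 4 * ((x ^ 3 - 8 * x ^ 2 + 17 * x - 5) * (x - 1)))"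
      unfolding poly_q_base by (simp only: mult_ac)
    also have "\<dots> = (t ^ 4 - 1) * (((t + 1) ^ 6 - 8 * t * (t + 1) ^ 4 + 17 * t ^ 2 * (t + 1) ^ 2 - 5 * t ^ 3) * ((t + 1) ^ 2 - t))"
      unfolding eq ..
    also have "\<dots> = spider 9 t"
      by (simp add: spider_def algebra_simps eval_nat_numeral)
    finally show ?case by (simp del: q.simps add: power2_eq_square)
  next
    case (3 k)
    have "t ^ 2 * (x ^ 2 - 4 * x + 2) = (t * x) ^ 2 - 4 * t * (t * x) + 2 * t ^ 2"
      by (simp add: algebra_simps power2_eq_square)
    also have "\<dots> = t ^ 4 + 1"
      unfolding xt by (simp add: algebra_simps eval_nat_numeral)
    finally have y: "t ^ 2 * (x ^ 2 - 4 * x + 2) = t ^ 4 + 1" .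
    have "t ^ (2 * Suc (Suc k) + 2) * (t ^ 4 - 1) * poly (of_int_poly (q (Suc (Suc k)))) x
       = (t ^ 2 * (x ^ 2 - 4 * x + 2)) * (t ^ (2 * Suc k + 2) * (t ^ 4 - 1) * poly (of_int_poly (q (Suc k))) x)
         - t ^ 4 * (t ^ (2 * k + 2) * (t ^ 4 - 1) * poly (of_int_poly (q k)) x)"
      unfolding poly_q_rec by (simp add: algebra_simps power_add eval_nat_numeral)
    also have "\<dots> = (t ^ 4 + 1) * spider (4 * Suc k + 5) t - t ^ 4 * spider (4 * k + 5) t"
      unfolding y 3 ..
    also have "\<dots> = spider (4 * Suc (Suc k) + 5) t"
      by (simp add: spider_def algebra_simps power_add eval_nat_numeral)
    finally show ?case ..
  qed
  then show ?thesis by (simp add: x_def)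
qed

section \<open>Irreducibility\<close>

lemma unit_circle_of_real_le_2:
  fixes s :: real
  assumes "\<bar>s\<bar> \<le> 2"
  obtains t where "cmod t = 1" "complex_of_real s = t + 1 / t"
proof -
  have "s\<^sup>2 \<le> 2\<^sup>2" using assms by (metis abs_ge_zero power2_abs power_mono)
  then have nn: "1 - (s / 2)\<^sup>2 \<ge> 0" by (simp add: power_divide)
  define t where "t = Complex (s / 2) (sqrt (1 - (s / 2)\<^sup>2))"
  have norm: "cmod t = 1" using nn by (simp add: t_def cmod_def)
  then have "1 / t = cnj t"
    by (metis complex_cnj_one complex_mod_mult_cnj divide_eq_eq mult.commute norm_eq_zero
        of_real_1 power_one zero_neq_one complex_norm_square)
  then have "t + 1 / t = complex_of_real s" by (simp add: t_def complex_eq_iff)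
  with norm show ?thesis using that by metis
qed

lemma q_factor_with_small_roots:
  fixes g :: "int poly"
  assumes dvd: "g dvd q k" and monic: "lead_coeff g = 1" and deg: "degree g > 0"
    and small: "\<And>x :: real. poly (of_int_poly g) x = 0 \<Longrightarrow> x \<le> 4"
  shows "poly g 1 = 0"
proof -
  \<comment> \<open>Shifting by 2 turns roots t + 1/t + 2 of \<open>g\<close> into roots t + 1/t of
    \<open>h\<close>.\<close>
  define h where "h = g \<circ>\<^sub>p [:2, 1:]"
  define G where "G = (of_int_poly g :: complex poly)"
  define H where "H = (of_int_poly h :: complex poly)"
  obtain f where f: "q k = g * f" using dvd by (elim dvdE)
  have H: "H = G \<circ>\<^sub>p [:2, 1:]"
    by (simp add: H_def h_def G_def of_int_hom.map_poly_pcompose map_poly_pCons map_poly_1)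
  have polyH: "poly H s = poly G (s + 2)" for s
    unfolding H poly_pcompose by (simp add: add.commute)
  have qG: "poly (of_int_poly (q k)) z = poly G z * poly (of_int_poly f) z" for z :: complex
    by (simp add: f G_def of_int_poly_hom.hom_mult)
  have monic_h: "lead_coeff h = 1" unfolding h_def by (subst lead_coeff_comp) (use monic in simp_all)
  have "H \<noteq> 0" using monic_h by (auto simp: H_def)
  have "rsquarefree H"
    unfolding rsquarefree_roots
  proof (intro allI notI, elim conjE)
    fix s assume s: "poly H s = 0" "poly (pderiv H) s = 0"
    then have "poly G (s + 2) = 0" "poly (pderiv G) (s + 2) = 0"
      unfolding H pderiv_pcompose poly_mult poly_pcompose by (simp_all add: add.commute pderiv_pCons)
    moreover have "pderiv (of_int_poly (q k)) = G * pderiv (of_int_poly f) + of_int_poly f * pderiv G"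
      by (simp add: f G_def of_int_poly_hom.hom_mult pderiv_mult)
    ultimately have "poly (of_int_poly (q k)) (s + 2) = 0" "poly (pderiv (of_int_poly (q k))) (s + 2) = 0"
      by (simp_all add: qG)
    then show False using q_root_simple by blast
  qed
  then have card: "card {s. poly H s = 0} = degree h"
    using \<open>H \<noteq> 0\<close> by (simp add: rsquarefree_card_degree H_def)
  have circle: "\<exists>t. cmod t = 1 \<and> s = t + 1 / t" if "poly H s = 0" for s
  proof -
    have root: "poly G (s + 2) = 0" using that by (simp add: polyH)
    then obtain x where x: "s + 2 = of_real x" "x > 0"
      using q_root_real[of k "s + 2"] qG by auto
    have "poly (of_int_poly g) x = 0"
      using root unfolding x(1) G_def poly_of_int_poly_of_real by (simp only: of_real_eq_0_iff)
    then have "x \<le> 4" by (rule small)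
    then have "\<bar>x - 2\<bar> \<le> 2" using x by linarith
    moreover have "s = of_real (x - 2)" using x(1) by (simp add: algebra_simps)
    ultimately show ?thesis using unit_circle_of_real_le_2 by metis
  qed
  define T where "T = {t. cmod t = 1 \<and> poly H (t + 1 / t) = 0}"
  obtain p0 where "\<forall>p\<ge>p0. prime p \<longrightarrow> (\<forall>t. cmod t = 1 \<longrightarrow> poly H (t + 1 / t) = 0 \<longrightarrow>
      poly H (t ^ p + 1 / t ^ p) = 0)"
    using large_primes_permute_roots[OF monic_h card[unfolded H_def] circle[unfolded H_def]]
    unfolding H_def by blast
  then have closed: "t ^ p \<in> T" if "p \<ge> p0" "prime p" "t \<in> T" for p t
    using that by (auto simp: T_def norm_power)
  have fin: "finite T"
  proof (rule finite_subset)
    \<comment> \<open>Each root s comes from at most two t, the zeros of X^2 - s X + 1.\<close>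
    show "T \<subseteq> (\<Union>s\<in>{s. poly H s = 0}. {t. poly [:1, - s, 1:] t = 0})"
    proof
      fix t assume t: "t \<in> T"
      then have "t \<noteq> 0" by (auto simp: T_def)
      then have "poly [:1, - (t + 1 / t), 1:] t = 0" by (simp add: algebra_simps)
      with t show "t \<in> (\<Union>s\<in>{s. poly H s = 0}. {t. poly [:1, - s, 1:] t = 0})"
        by (auto simp: T_def)
    qed
    show "finite (\<Union>s\<in>{s. poly H s = 0}. {t. poly [:1, - s, 1:] t = 0})"
      using \<open>H \<noteq> 0\<close> by (intro finite_UN_I poly_roots_finite) auto
  qed
  have nz: "0 \<notin> T" by (auto simp: T_def)
  have qT: "poly (of_int_poly (q k)) (t + 1 / t + 2) = 0" if "t \<in> T" for t
    using that by (simp add: T_def polyH qG)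
  have spider: "spider (4 * k + 5) t = 0" if "t \<in> T" for t
    using that nz qT[OF that] by (subst spider_eq_q) auto
  have "degree H > 0" using deg by (simp add: H_def h_def degree_pcompose)
  then obtain s where s: "poly H s = 0"
    using fundamental_theorem_of_algebra_alt[of H] by (metis degree_pCons_0 less_irrefl)
  then obtain t where t: "cmod t = 1" "s = t + 1 / t" using circle by blast
  with s have "t \<in> T" by (simp add: T_def)
  have nonroot: "s \<noteq> of_int (m - 2)" if "poly (q k) m \<noteq> 0" for m
  proof
    assume "s = of_int (m - 2)"
    then have "poly (of_int_poly (q k)) (complex_of_int m) = 0"
      using qT[OF \<open>t \<in> T\<close>] t(2) by simp
    then show False using that by (simp add: of_int_hom.poly_map_poly)
  qed
  have "t \<noteq> 0" using t by auto
  have "t ^ 4 = 1 \<or> t ^ 2 + t + 1 = 0"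
    using spider_torsion[OF fin nz closed _ spider \<open>t \<in> T\<close>] by simp
  then have "s = -1"
  proof
    assume "t ^ 2 + t + 1 = 0"
    then have "t * (t + 1 / t) = t * (-1)" using \<open>t \<noteq> 0\<close> by (simp add: algebra_simps power2_eq_square eq_neg_iff_add_eq_0)
    then show ?thesis using \<open>t \<noteq> 0\<close> t(2) by (metis mult_cancel_left)
  next
    assume "t ^ 4 = 1"
    then have "(t\<^sup>2)\<^sup>2 = 1" by (simp flip: power_mult)
    then consider "t = 1" | "t = -1" | "t\<^sup>2 = -1"
      by (metis power2_eq_1_iff)
    then show ?thesis
    proof cases
      case 1
      then show ?thesis using nonroot[of 4] poly_q_4[of k] t(2) by simp
    next
      case 2
      then show ?thesis using nonroot[of 0] poly_q_0[of k] t(2) by simp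
    next
      case 3
      then have "t * (t + 1 / t) = t * 0" using \<open>t \<noteq> 0\<close> by (simp add: algebra_simps power2_eq_square)
      then have "s = 0" using \<open>t \<noteq> 0\<close> t(2) by (metis mult_cancel_left)
      then show ?thesis using nonroot[of 2] poly_q_2[of k] by simp
    qed
  qed
  then have "poly G (of_int 1) = 0" using s polyH by simp
  then show ?thesis unfolding G_def of_int_hom.poly_map_poly by simp
qed

section \<open>From q to r\<close>

lemma q_eq_r:
  assumes "k mod 3 = 1"
  shows "q k = [:-1, 1:] * r k"
proof -
  have "[:-1, 1:] dvd q k" using assms poly_q_1_eq_0_iff[of k] unfolding poly_eq_0_iff_dvd by blast
  then have "[:-1, 1:] * (q k div [:-1, 1:]) = q k" by (rule dvd_mult_div_cancel)
  then show ?thesis using assms unfolding r_def by presburger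
qed

lemma r_dvd_q: "r k dvd q k"
proof (cases "k mod 3 = 1")
  case True
  then show ?thesis using q_eq_r by (metis dvd_triv_right)
qed (simp add: r_def)

lemma r_monic: "lead_coeff (r k) = 1" and degree_r_pos: "degree (r k) > 0"
proof -
  have "lead_coeff (r k) = 1 \<and> degree (r k) > 0"
  proof (cases "k mod 3 = 1")
    case True
    have "lead_coeff (q k) = lead_coeff [:-1, 1 :: int:] * lead_coeff (r k)"
      unfolding q_eq_r[OF True] by (rule lead_coeff_mult)
    then have "lead_coeff (r k) = 1" unfolding q_monic[THEN conjunct2] by simp
    moreover have "degree (q k) = degree [:-1, 1 :: int:] + degree (r k)"
      unfolding q_eq_r[OF True] using calculation by (intro degree_mult_eq) auto
    ultimately show ?thesis using q_monic[of k, THEN conjunct1] by simp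
  next
    case False
    then have "r k = q k" by (simp add: r_def)
    moreover have "degree (q k) > 0" using q_monic[of k, THEN conjunct1] by simp
    ultimately show ?thesis using q_monic[of k, THEN conjunct2] by metis
  qed
  then show "lead_coeff (r k) = 1" "degree (r k) > 0" by auto
qed

lemma q_no_common_factor_root:
  fixes z :: complex
  assumes "f * g dvd q k" "poly (of_int_poly f) z = 0" "poly (of_int_poly g) z = 0"
  shows False
proof -
  obtain h where h: "q k = f * g * h" using assms(1) by (elim dvdE)
  have "poly (of_int_poly (q k)) z = 0" using assms(2) by (simp add: h of_int_poly_hom.hom_mult)
  moreover have "poly (pderiv (of_int_poly (q k))) z = 0"
    using assms(2,3) by (simp add: h of_int_poly_hom.hom_mult pderiv_mult)
  ultimately show False using q_root_simple by blast
qed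

text \<open>Each nonconstant factor must have a root beyond 4. There is only one such root of
  \<open>q k\<close>, so the factors share it, contradicting simplicity.\<close>

lemma r_monic_factor_degree:
  fixes f g :: "int poly"
  assumes fg: "r k = f * g" and monic: "lead_coeff f = 1" "lead_coeff g = 1"
  shows "degree f = 0 \<or> degree g = 0"
proof (rule ccontr)
  assume "\<not> (degree f = 0 \<or> degree g = 0)"
  then have deg: "degree f > 0" "degree g > 0" by auto
  have dvd: "f * g dvd q k" using r_dvd_q[of k] fg by simp
  then have dvds: "f dvd q k" "g dvd q k"
    by (meson dvd_trans dvd_triv_left dvd_triv_right)+
  have root: "poly (of_int_poly (q k)) x = 0" if "poly (of_int_poly f) x = 0 \<or> poly (of_int_poly g) x = 0" for x :: real
  proof -
    obtain h where "q k = f * g * h" using dvd by (elim dvdE)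
    then show ?thesis using that by (auto simp: of_int_poly_hom.hom_mult)
  qed
  \<comment> \<open>If k is 1 modulo 3, the root 1 has been divided out, and a second occurrence in
    \<open>r k\<close> would make it a double root of \<open>q k\<close>.\<close>
  have no1: "poly f 1 \<noteq> 0 \<and> poly g 1 \<noteq> 0"
  proof (cases "k mod 3 = 1")
    case True
    have eq: "[:-1, 1:] * r k dvd q k" using q_eq_r[OF True] by simp
    have r1: "poly (r k) 1 \<noteq> 0"
    proof
      assume "poly (r k) 1 = 0"
      then have "poly (of_int_poly (r k)) (of_int 1 :: complex) = 0"
        unfolding of_int_hom.poly_map_poly by simp
      moreover have "poly (of_int_poly [:-1, 1:]) (of_int 1 :: complex) = 0"
        unfolding of_int_hom.poly_map_poly by simp
      ultimately show False using q_no_common_factor_root[OF eq] by blast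
    qed
    then show ?thesis by (simp add: fg)
  next
    case False
    then have "poly (q k) 1 \<noteq> 0" using poly_q_1_eq_0_iff by blast
    then show ?thesis using False fg by (auto simp: r_def)
  qed
  obtain x :: real where x: "poly (of_int_poly f) x = 0" "x > 4"
    using q_factor_with_small_roots[OF dvds(1) monic(1) deg(1)] no1 by force
  obtain y :: real where y: "poly (of_int_poly g) y = 0" "y > 4"
    using q_factor_with_small_roots[OF dvds(2) monic(2) deg(2)] no1 by force
  have "x = y" using q_root_gt_4_unique root x y by blast
  then have "poly (of_int_poly f) (complex_of_real x) = 0" "poly (of_int_poly g) (complex_of_real x) = 0"
    using x y unfolding poly_of_int_poly_of_real by simp_all
  then show False using q_no_common_factor_root[OF dvd] by blast
qed

text \<open>Gauss's lemma reduces the claim to integer factorizations. Their leading coefficients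
  are both 1 or both -1, and negating both factors makes them monic.\<close>

lemma irreducible_r: "irreducible (map_poly (of_int :: int \<Rightarrow> rat) (r k))"
proof -
  have "irreducible\<^sub>d (r k)"
    unfolding irreducible\<^sub>d_def
  proof (intro conjI allI impI notI)
    fix f g assume lt: "degree f < degree (r k)" "degree g < degree (r k)" and fg: "r k = f * g"
    have lc: "lead_coeff f * lead_coeff g = 1"
      using r_monic[of k] unfolding fg lead_coeff_mult .
    then have nz: "f \<noteq> 0" "g \<noteq> 0" by auto
    from lc have "lead_coeff f = 1 \<and> lead_coeff g = 1 \<or> lead_coeff f = -1 \<and> lead_coeff g = -1"
      using zmult_eq_1_iff by blast
    then have "degree f = 0 \<or> degree g = 0"
      using r_monic_factor_degree[of k f g] r_monic_factor_degree[of k "- f" "- g"] fg by auto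
    moreover have "degree (r k) = degree f + degree g"
      unfolding fg using nz by (rule degree_mult_eq)
    ultimately show False using lt by auto
  qed (rule degree_r_pos)
  then have "irreducible\<^sub>d (map_poly (of_int :: int \<Rightarrow> rat) (r k))" by (rule irreducible\<^sub>d_int_rat)
  then show ?thesis by simp
qed

text \<open>The sign change beyond 4 shows that the maximum is attained and exceeds 4; hence it
  differs from 1 and survives division by x - 1.\<close>

lemma r_root_d: "poly (map_poly (of_int :: int \<Rightarrow> real) (r k)) (d k) = 0"
proof -
  define Q where "Q = (of_int_poly (q k) :: real poly)"
  define R where "R = {x. poly Q x = 0}"
  have lc: "lead_coeff Q = 1" using q_monic[of k, THEN conjunct2] by (simp add: Q_def)
  then have "Q \<noteq> 0" by auto
  then have fin: "finite R" unfolding R_def by (rule poly_roots_finite)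
  have "poly Q (of_int 4) = of_int (- (2 * int k + 1))"
    unfolding Q_def of_int_hom.poly_map_poly poly_q_4 ..
  then have neg: "poly Q 4 < 0" by simp
  obtain n where n: "\<And>x. x \<ge> n \<Longrightarrow> poly Q x \<ge> 1"
    using poly_pinfty_gt_lc[of Q] lc by auto
  have "poly Q (max n 5) > 0" using n[of "max n 5"] by simp
  moreover have "4 < max n 5" by (simp add: less_max_iff_disj)
  ultimately obtain x where x: "4 < x" "poly Q x = 0"
    using poly_IVT_pos[of 4 "max n 5" Q] neg by blast
  then have "x \<in> R" by (simp add: R_def)
  have dk: "d k = Max R" by (simp add: d_def R_def Q_def)
  have "d k \<in> R" unfolding dk using fin \<open>x \<in> R\<close> by (intro Max_in) auto
  moreover have "d k > 4" unfolding dk using Max_ge[OF fin \<open>x \<in> R\<close>] x(1) by linarith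
  ultimately have dR: "poly Q (d k) = 0" "d k \<noteq> 1" by (auto simp: R_def)
  show ?thesis
  proof (cases "k mod 3 = 1")
    case True
    have "poly Q (d k) = poly (of_int_poly [:-1, 1:]) (d k) * poly (of_int_poly (r k)) (d k)"
      unfolding Q_def q_eq_r[OF True] by (simp only: of_int_poly_hom.hom_mult poly_mult)
    then show ?thesis using dR by (simp add: map_poly_pCons map_poly_1)
  qed (use dR in \<open>simp add: r_def Q_def\<close>)
qed

theorem mainTheorem2:
  shows "(k mod 3 = 1 \<longrightarrow> q k = [:-1, 1:] * r k)
       \<and> irreducible (map_poly (of_int :: int \<Rightarrow> rat) (r k))
       \<and> lead_coeff (r k) = 1
       \<and> poly (map_poly (of_int :: int \<Rightarrow> real) (r k)) (d k) = 0"
  using q_eq_r irreducible_r r_monic r_root_d by blast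

end
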